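(* Let $n\geq 3$ and $2\leq \ell\leq n-2$ be integers, and let $G_\ell$ be the graph obtained from the complete graph $K_{n+1}$ on vertex set $\{0,1,\ldots,n\}$ (with root $0$) by deleting the $\ell$ edges joining vertex $1$ to the vertices in $F_\ell=\{n-\ell+1,\ldots,n\}$. Then the set $\mathrm{sPF}(G_\ell)$ of spherical $G_\ell$-parking functions satisfies $$|\mathrm{sPF}(G_\ell)| = (n-1)^{n-3}\,(n-\ell-1)^2.$$
   Context: $\mathbb{N}$ denotes the non-negative integers and $[n]=\{1,\ldots,n\}$. Let $G$ be a connected simple graph with vertex set $\{0,1,\ldots,n\}$ and root $0$. For a non-empty $A\subseteq[n]$ and $i\in A$, let $d_A(i)$ be the number of edges of $G$ from $i$ to vertices of $\{0,1,\ldots,n\}\setminus A$, and let $m_A=\prod_{i\in A}x_i^{d_A(i)}$ in the polynomial ring $R=\mathbb{K}[x_1,\ldots,x_n]$ over a field $\mathbb{K}$. Let $\mathcal{M}_G=\langle m_A : \emptyset\neq A\subseteq [n]\rangle$ and $\mathcal{M}_G^{(n-2)}=\langle m_A : \emptyset\neq A\subseteq[n],\ |A|\leq n-1\rangle$, both monomial ideals of $R$. A function $\mathcal{P}\colon[n]\to\mathbb{N}$ is a spherical $G$-parking function if the monomial $\prod_{i\in[n]}x_i^{\mathcal{P}(i)}$ belongs to $\mathcal{M}_G\setminus\mathcal{M}_G^{(n-2)}$. The set of all of them is denoted $\mathrm{sPF}(G)$. *)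

theory Defs
  imports Complex_Main "HOL-Library.Poly_Mapping" "HOL-Library.FuncSet" "HOL-Algebra.Ideal"
begin

text \<open>
  A simple graph on the vertex set \<open>{0..n}\<close>, with root \<open>0\<close>, is given by \<open>n\<close> together with its set \<open>E\<close>
  of edges, each edge being a two-element set of vertices.
\<close>

definition simple_graph :: "nat \<Rightarrow> nat set set \<Rightarrow> bool" where
  "simple_graph n E \<longleftrightarrow> (\<forall>e\<in>E. \<exists>u v. u \<le> n \<and> v \<le> n \<and> u \<noteq> v \<and> e = {u, v})"

definition connected_graph :: "nat \<Rightarrow> nat set set \<Rightarrow> bool" where
  "connected_graph n E \<longleftrightarrow> (\<forall>u\<le>n. \<forall>v\<le>n. (u, v) \<in> {(a, b). {a, b} \<in> E}\<^sup>*)"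

definition complete_edges :: "nat \<Rightarrow> nat set set" where
  "complete_edges n = {{u, v} | u v. u \<le> n \<and> v \<le> n \<and> u \<noteq> v}"

definition G_edges :: "nat \<Rightarrow> nat \<Rightarrow> nat set set" where
  "G_edges n l = complete_edges n - {{1, v} | v. v \<in> {n - l + 1..n}}"

definition out_deg :: "nat \<Rightarrow> nat set set \<Rightarrow> nat set \<Rightarrow> nat \<Rightarrow> nat" where
  "out_deg n E A i = card {e \<in> E. \<exists>j \<in> {0..n} - A. e = {i, j}}"

text \<open>
  \<open>'k mpoly\<close> is the ring of polynomials over \<open>'k\<close> in the variables \<open>x\<^sub>i\<close> for all \<open>i :: nat\<close> (finitely
  supported functions from exponent vectors to coefficients); \<open>poly_ring n\<close> is its subring of
  polynomials in which only \<open>x\<^sub>1, \<dots>, x\<^sub>n\<close> occur.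
\<close>

type_synonym 'k mpoly = "(nat \<Rightarrow>\<^sub>0 nat) \<Rightarrow>\<^sub>0 'k"

definition Var :: "nat \<Rightarrow> 'k::field mpoly" where
  "Var i = Poly_Mapping.single (Poly_Mapping.single i 1) 1"

definition poly_ring :: "nat \<Rightarrow> 'k::field mpoly ring" where
  "poly_ring n =
    \<lparr>carrier = {p. \<forall>t \<in> Poly_Mapping.keys p. Poly_Mapping.keys t \<subseteq> {1..n}},
     monoid.mult = (*), one = 1, ring.zero = 0, add = (+)\<rparr>"

definition cut_monomial :: "nat \<Rightarrow> nat set set \<Rightarrow> nat set \<Rightarrow> 'k::field mpoly" where
  "cut_monomial n E A = (\<Prod>i\<in>A. Var i ^ out_deg n E A i)"

definition parking_ideal :: "nat \<Rightarrow> nat set set \<Rightarrow> 'k::field mpoly set" where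
  "parking_ideal n E =
    Idl\<^bsub>poly_ring n\<^esub> {cut_monomial n E A | A. A \<noteq> {} \<and> A \<subseteq> {1..n}}"

definition skeleton_ideal :: "nat \<Rightarrow> nat set set \<Rightarrow> 'k::field mpoly set" where
  "skeleton_ideal n E =
    Idl\<^bsub>poly_ring n\<^esub> {cut_monomial n E A | A. A \<noteq> {} \<and> A \<subseteq> {1..n} \<and> card A \<le> n - 1}"

text \<open>
  Functions on \<open>{1..n}\<close> are extensional functions \<open>nat \<Rightarrow> nat\<close>, so that distinct elements of \<open>sPF\<close>
  differ on \<open>{1..n}\<close>.  The \<open>itself\<close> argument is the coefficient field.
\<close>

definition sPF :: "'k::field itself \<Rightarrow> nat \<Rightarrow> nat set set \<Rightarrow> (nat \<Rightarrow> nat) set" where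
  "sPF K n E =
    {P \<in> {1..n} \<rightarrow>\<^sub>E UNIV.
      ((\<Prod>i\<in>{1..n}. Var i ^ P i) :: 'k mpoly) \<in> parking_ideal n E - skeleton_ideal n E}"

lemma poly_ring_simps [simp]:
  "x \<oplus>\<^bsub>poly_ring n\<^esub> y = x + y" "x \<otimes>\<^bsub>poly_ring n\<^esub> y = x * y"
  "\<zero>\<^bsub>poly_ring n\<^esub> = 0" "\<one>\<^bsub>poly_ring n\<^esub> = 1"
  by (simp_all add: poly_ring_def)

lemma cring_poly_ring: "cring (poly_ring n :: 'k::field mpoly ring)"
proof (rule cringI)
  let ?R = "poly_ring n :: 'k mpoly ring"
  have add_closed: "x + y \<in> carrier ?R" if "x \<in> carrier ?R" "y \<in> carrier ?R" for x y
    using that Poly_Mapping.keys_add[of x y] by (fastforce simp: poly_ring_def)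
  have mult_closed: "x * y \<in> carrier ?R" if xy: "x \<in> carrier ?R" "y \<in> carrier ?R" for x y
  proof -
    have "Poly_Mapping.keys t \<subseteq> {1..n}" if t: "t \<in> Poly_Mapping.keys (x * y)" for t
    proof -
      obtain a b where ab: "a \<in> Poly_Mapping.keys x" "b \<in> Poly_Mapping.keys y" "t = a + b"
        using t Poly_Mapping.keys_mult[of x y] by blast
      then have "Poly_Mapping.keys a \<subseteq> {1..n}" "Poly_Mapping.keys b \<subseteq> {1..n}"
        using xy by (auto simp: poly_ring_def)
      then show ?thesis
        using Poly_Mapping.keys_add[of a b] ab(3) by blast
    qed
    then show ?thesis by (simp add: poly_ring_def)
  qed
  have zero_one: "0 \<in> carrier ?R" "1 \<in> carrier ?R"
    by (simp_all add: poly_ring_def)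
  show "abelian_group ?R"
  proof (rule abelian_groupI)
    fix x assume x: "x \<in> carrier ?R"
    have "- x \<in> carrier ?R" using x by (simp add: poly_ring_def)
    then show "\<exists>y\<in>carrier ?R. y \<oplus>\<^bsub>?R\<^esub> x = \<zero>\<^bsub>?R\<^esub>"
      by (intro bexI[of _ "- x"]) simp_all
  qed (simp_all add: add_closed zero_one ac_simps)
  show "Group.comm_monoid ?R"
    by (rule comm_monoidI) (simp_all add: mult_closed zero_one ac_simps)
qed (simp add: distrib_right)

lemma simple_graph_G_edges: "simple_graph n (G_edges n l)"
  by (auto simp: simple_graph_def G_edges_def complete_edges_def)

lemma connected_graph_G_edges:
  assumes "l \<le> n - 2" "3 \<le> n"
  shows "connected_graph n (G_edges n l)"
proof -
  let ?r = "{(a, b). {a, b} \<in> G_edges n l}"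
  have edge0: "{0, v} \<in> G_edges n l" if "v \<le> n" "v \<noteq> 0" for v
    using that assms by (auto simp: G_edges_def complete_edges_def doubleton_eq_iff)
  have "(u, 0) \<in> ?r\<^sup>* \<and> (0, u) \<in> ?r\<^sup>*" if "u \<le> n" for u
    using edge0[OF that] by (cases "u = 0") (auto simp: insert_commute)
  then show ?thesis
    unfolding connected_graph_def by (meson rtrancl_trans)
qed

end

theory Submission
  imports Defs
begin

text \<open>
  A monomial lies in a monomial ideal iff one of the generators divides it.  As the root is joined to
  every vertex, \<open>P\<close> is therefore spherical iff all its values are positive and every non-empty
  \<open>A \<subset> {1..n}\<close> contains an \<open>i\<close> with \<open>P i < out_deg n E A i\<close> (\<open>sPF_iff\<close>).

  For \<open>G_edges n l\<close> this is a parking problem.  Let the \<open>M = n - 1\<close> vertices \<open>2, \<dots>, n\<close> be cars on a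
  circle with spots \<open>0, \<dots>, M - 1\<close>; a car parks in the first free spot from its preferred one on.
  Car \<open>i\<close> starts at spot \<open>P i - 1\<close> and prefers \<open>R i = P i - 1\<close>, except that a car of
  \<open>F = {n - l + 1..n}\<close> (a vertex not joined to \<open>1\<close>) prefers the next spot, \<open>R i = P i\<close>, and so always
  crosses the border in front of \<open>R i\<close>.  Applied to the sets \<open>A\<close> without \<open>1\<close>, the condition says that
  all preferences are spots and no car crosses the border in front of spot \<open>0\<close>;
  applied to the sets with \<open>1\<close>, it says that \<open>P 1\<close> is at most the number of cars in
  \<open>N = {2..n - l}\<close> that prefer a spot before the first uncrossed border \<open>c \<ge> 1\<close> (\<open>sPF_G_iff\<close>).
  Hence the spherical functions are as numerous as the pairs of such an \<open>R\<close> and a car \<open>i \<in> N\<close> whose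
  preference lies in the first block, where a block is a stretch between two consecutive
  uncrossed borders (\<open>card_sPF_eq_sum\<close>).

  It remains to count, for a fixed \<open>i\<close>, the \<open>R\<close> whose border in front of \<open>0\<close> is uncrossed and whose
  first block contains \<open>R i\<close>.  Each \<open>R\<close> with some uncrossed border has exactly one rotation
  with this property: the one that brings the block of car \<open>i\<close> to the front.  So the number is
  \<open>1 / M\<close> times the number \<open>u F\<close> of all \<open>R\<close> that have an uncrossed border
  (\<open>card_uncrossable_first_block\<close>).

  Finally \<open>u F\<close> drops by a constant when a car \<open>j\<close> joins \<open>F\<close>: lost are the \<open>R\<close> whose only
  uncrossed border is the one in front of \<open>R j\<close>.  Rotated to \<open>R j = 0\<close> and with the cars of \<open>F\<close> put
  back by one spot, these are the ordinary parking functions of the remaining \<open>M - 1\<close> cars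
  (\<open>card_uncrossable_insert\<close>, \<open>card_only_block\<close>).  Every \<open>R\<close> has an uncrossed border when \<open>F = {}\<close>, and
  none has one when \<open>F\<close> contains all cars.  So \<open>u\<close> decreases linearly from \<open>M ^ M\<close> to \<open>0\<close>, whence
  \<open>u F = (M - card F) * M ^ (M - 1)\<close> (\<open>card_uncrossable\<close>).  Each of the \<open>n - l - 1\<close> cars of \<open>N\<close> therefore contributes
  \<open>(n - l - 1) * (n - 1) ^ (n - 3)\<close>.
\<close>

section \<open>Cars on a circle and uncrossed borders\<close>

locale parking_circle =
  fixes I :: "'a set"
  assumes finite_I: "finite I" and nonempty_I: "I \<noteq> {}"
begin

definition M :: int where "M = int (card I)"

definition prefs :: "('a \<Rightarrow> int) set" where
  "prefs = I \<rightarrow>\<^sub>E {0..<M}"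

definition rot :: "int \<Rightarrow> ('a \<Rightarrow> int) \<Rightarrow> 'a \<Rightarrow> int" where
  "rot t R = (\<lambda>i\<in>I. (R i + t) mod M)"

text \<open>
  For \<open>R\<close> with values in \<open>{0..<M}\<close> and \<open>0 \<le> c \<le> M\<close> this is the number of cars preferring a spot before
  \<open>c\<close> minus the number \<open>c\<close> of these spots (\<open>walk_eq_card\<close>); the formula is its \<open>M\<close>-periodic
  extension to all integers, which makes rotation a mere shift.
\<close>

definition walk :: "('a \<Rightarrow> int) \<Rightarrow> int \<Rightarrow> int" where
  "walk R c = - c - (\<Sum>i\<in>I. (R i - c) div M)"

text \<open>
  The number of cars that cross the border in front of spot \<open>c\<close> in order to park is \<open>walk R c\<close> minus
  the minimum of \<open>walk R\<close>, not counting the cars of \<open>F\<close> that prefer \<open>c\<close> itself: these come from the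
  spot before and always cross.
\<close>

definition uncrossed :: "'a set \<Rightarrow> ('a \<Rightarrow> int) \<Rightarrow> int \<Rightarrow> bool" where
  "uncrossed F R c \<longleftrightarrow> (\<forall>d. walk R c \<le> walk R d) \<and> (\<forall>i\<in>F. \<not> M dvd R i - c)"

lemma M_pos: "0 < M"
  using finite_I nonempty_I by (simp add: M_def card_gt_0_iff)

lemma finite_prefs: "finite prefs"
  unfolding prefs_def using finite_I by (intro finite_PiE) auto

lemma card_prefs: "card prefs = card I ^ card I"
  using finite_I by (simp add: prefs_def card_PiE M_def)

lemma prefs_bounds: "R \<in> prefs \<Longrightarrow> i \<in> I \<Longrightarrow> 0 \<le> R i \<and> R i < M"
  by (auto simp: prefs_def)

lemma prefs_ext: "R \<in> prefs \<Longrightarrow> S \<in> prefs \<Longrightarrow> (\<And>i. i \<in> I \<Longrightarrow> R i = S i) \<Longrightarrow> R = S"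
  unfolding prefs_def by (rule PiE_ext)

lemma rot_prefs: "rot t R \<in> prefs"
  using M_pos by (auto simp: rot_def prefs_def)

lemma rot_rot: "rot s (rot t R) = rot (s + t) R"
proof
  fix i show "rot s (rot t R) i = rot (s + t) R i"
    by (simp add: rot_def mod_simps algebra_simps)
qed

lemma rot_mod: "rot (t mod M) R = rot t R"
  by (auto simp: rot_def mod_add_right_eq restrict_def)

lemma rot_0: "R \<in> prefs \<Longrightarrow> rot 0 R = R"
  by (rule prefs_ext[OF rot_prefs]) (auto simp: rot_def dest: prefs_bounds)

lemma walk_rot: "walk (rot t R) c = walk R (c - t) - t + (\<Sum>i\<in>I. (R i + t) div M)"
proof -
  have "((R i + t) mod M - c) div M = (R i - (c - t)) div M - (R i + t) div M" for i
  proof -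
    have "(R i + t) mod M - c = (R i - (c - t)) + (- ((R i + t) div M)) * M"
      by (simp add: minus_div_mult_eq_mod [symmetric])
    then show ?thesis using M_pos by (simp only: div_mult_self1)
  qed
  then have "(\<Sum>i\<in>I. (rot t R i - c) div M) =
      (\<Sum>i\<in>I. (R i - (c - t)) div M) - (\<Sum>i\<in>I. (R i + t) div M)"
    by (simp add: rot_def sum_subtractf)
  then show ?thesis by (simp add: walk_def)
qed

lemma walk_periodic: "walk R (c + k * M) = walk R c"
proof -
  have "(R i - (c + k * M)) div M = (R i - c) div M - k" for i
  proof -
    have "R i - (c + k * M) = (R i - c) + (- k) * M" by simp
    then show ?thesis using M_pos by (simp only: div_mult_self1)
  qed
  then show ?thesis by (simp add: walk_def sum_subtractf M_def)
qed

lemma walk_mod: "walk R (c mod M) = walk R c"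
  using walk_periodic[of R "c mod M" "c div M"] by simp

lemma uncrossed_mod: "uncrossed F R (c mod M) \<longleftrightarrow> uncrossed F R c"
proof -
  have "M dvd R i - c mod M \<longleftrightarrow> M dvd R i - c" for i
    by (simp add: mod_eq_dvd_iff[symmetric])
  then show ?thesis by (simp add: uncrossed_def walk_mod)
qed

lemma uncrossed_rot:
  assumes "F \<subseteq> I"
  shows "uncrossed F (rot t R) c \<longleftrightarrow> uncrossed F R (c - t)"
proof -
  have 1: "(\<forall>d. walk R (c - t) \<le> walk R (d - t)) \<longleftrightarrow> (\<forall>d. walk R (c - t) \<le> walk R d)"
    by (metis add_diff_cancel)
  have "M dvd rot t R i - c \<longleftrightarrow> M dvd R i - (c - t)" if "i \<in> F" for i
  proof -
    have "i \<in> I" using that assms by blast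
    then have "M dvd rot t R i - c \<longleftrightarrow> M dvd (R i + t) mod M - c"
      by (simp add: rot_def)
    also have "\<dots> \<longleftrightarrow> M dvd R i + t - c" by (simp add: mod_eq_dvd_iff[symmetric])
    finally show ?thesis by (simp add: algebra_simps)
  qed
  then show ?thesis using 1 by (simp add: uncrossed_def walk_rot)
qed

lemma walk_eq_card:
  assumes "R \<in> prefs" "0 \<le> c" "c \<le> M"
  shows "walk R c = int (card {i\<in>I. R i < c}) - c"
proof -
  have "(R i - c) div M = - of_bool (R i < c)" if "i \<in> I" for i
  proof (cases "R i < c")
    case True
    have "(R i - c) div M = -1"
      by (rule int_div_pos_eq[where r = "R i - c + M"])
        (use True assms prefs_bounds[OF assms(1) that] in auto)
    then show ?thesis using True by simp
  next
    case False
    then show ?thesis using assms prefs_bounds[OF assms(1) that]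
      by (simp add: div_pos_pos_trivial)
  qed
  then have "walk R c = (\<Sum>i\<in>I. of_bool (R i < c)) - c"
    by (simp add: walk_def sum_negf)
  also have "(\<Sum>i\<in>I. of_bool (R i < c)) = int (card {i\<in>I. R i < c})"
    using finite_I by (simp add: of_bool_def sum.If_cases Int_def)
  finally show ?thesis .
qed

lemma walk_0: assumes "R \<in> prefs" shows "walk R 0 = 0"
proof -
  have "{i\<in>I. R i < 0} = {}" using prefs_bounds[OF assms] by force
  then show ?thesis using walk_eq_card[OF assms, of 0] M_pos by (simp del: Collect_empty_eq)
qed

text \<open>
  This is the cycle lemma: by periodicity the walk attains its minimum.
\<close>

lemma exists_uncrossed_empty: "\<exists>c. uncrossed {} R c"
proof -
  have "\<exists>c. is_arg_min (walk R) (\<lambda>c. c \<in> {0..<M}) c"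
    using M_pos by (intro ex_is_arg_min_if_finite) auto
  then obtain c where c: "c \<in> {0..<M}" "\<And>d. d \<in> {0..<M} \<Longrightarrow> walk R c \<le> walk R d"
    by (auto simp: is_arg_min_linorder)
  have "walk R c \<le> walk R d" for d
    using c(2)[of "d mod M"] M_pos by (simp add: walk_mod)
  then show ?thesis by (auto simp: uncrossed_def)
qed

lemma uncrossed_0_iff:
  assumes R: "R \<in> prefs" and F: "F \<subseteq> I"
  shows "uncrossed F R 0 \<longleftrightarrow>
    (\<forall>c\<in>{1..M}. c \<le> int (card {i\<in>I. R i < c})) \<and> (\<forall>i\<in>F. R i \<noteq> 0)"
proof -
  have w0: "walk R 0 = 0" using R by (rule walk_0)
  have "M dvd R i \<longleftrightarrow> R i = 0" if "i \<in> F" for i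
    using prefs_bounds[OF R, of i] F that zdvd_not_zless[of "R i" M] by (auto simp: less_le)
  moreover have "(\<forall>d. 0 \<le> walk R d) \<longleftrightarrow> (\<forall>c\<in>{1..M}. 0 \<le> walk R c)"
  proof safe
    fix d assume *: "\<forall>c\<in>{1..M}. 0 \<le> walk R c"
    show "0 \<le> walk R d"
    proof (cases "d mod M = 0")
      case True then show ?thesis using walk_mod[of R d] w0 by simp
    next
      case False
      then have "d mod M \<in> {1..M}"
        using M_pos pos_mod_sign[of M d] pos_mod_bound[of M d] by (simp del: pos_mod_bound pos_mod_sign)
      then show ?thesis using * walk_mod[of R d] by metis
    qed
  qed auto
  moreover have "(\<forall>c\<in>{1..M}. 0 \<le> walk R c) \<longleftrightarrow> (\<forall>c\<in>{1..M}. c \<le> int (card {i\<in>I. R i < c}))"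
    by (rule ball_cong) (auto simp: walk_eq_card[OF R])
  ultimately show ?thesis by (simp add: uncrossed_def w0)
qed

lemma uncrossed_0_pos:
  assumes "R \<in> prefs" "F \<subseteq> I" "uncrossed F R 0" "i \<in> F"
  shows "0 < R i"
  using assms uncrossed_0_iff[of R F] prefs_bounds[of R i] by (auto simp: less_le)

text \<open>
  If nobody crosses the border in front of \<open>0\<close>, then at least \<open>c\<close> cars prefer the first \<open>c\<close> spots, and
  the border in front of \<open>c\<close> is crossed by the surplus and by the cars of \<open>F\<close> preferring \<open>c\<close>.  The value \<open>c = M\<close> is included: it
  is the border in front of \<open>0\<close> again.
\<close>

lemma uncrossed_iff_tight:
  assumes R: "R \<in> prefs" and F: "F \<subseteq> I" and 0: "uncrossed F R 0" and c: "c \<in> {1..M}"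
  shows "uncrossed F R c \<longleftrightarrow> int (card {i\<in>I. R i < c}) = c \<and> (\<forall>i\<in>F. R i \<noteq> c)"
proof -
  have w0: "walk R 0 = 0" using R by (rule walk_0)
  have ge: "0 \<le> walk R d" for d using 0 w0 by (simp add: uncrossed_def)
  have "M dvd R i - c \<longleftrightarrow> R i = c" if i: "i \<in> F" for i
  proof
    assume d: "M dvd R i - c"
    have b: "0 < R i" "R i < M"
      using uncrossed_0_pos[OF R F 0 i] prefs_bounds[OF R, of i] F i by auto
    have "\<bar>R i - c\<bar> < \<bar>M\<bar>" using b c by auto
    then show "R i = c" using d dvd_imp_le_int[of "R i - c" M] by fastforce
  qed simp
  moreover have "(\<forall>d. walk R c \<le> walk R d) \<longleftrightarrow> walk R c = 0"
    using ge w0 by (metis order_antisym)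
  ultimately show ?thesis using c by (auto simp: uncrossed_def walk_eq_card[OF R])
qed

section \<open>Counting up to rotation\<close>

text \<open>
  The common pattern of the two rotation arguments below: \<open>X\<close> picks exactly one representative from
  each of the free rotation orbits that make up \<open>G\<close>.
\<close>

lemma card_rot_orbits:
  assumes X: "X \<subseteq> prefs" and G: "G \<subseteq> prefs"
    and G_iff: "\<And>R. R \<in> prefs \<Longrightarrow> R \<in> G \<longleftrightarrow> (\<exists>t. rot t R \<in> X)"
    and uniq: "\<And>R t. R \<in> X \<Longrightarrow> rot t R \<in> X \<Longrightarrow> 0 < t \<Longrightarrow> t < M \<Longrightarrow> False"
  shows "card G = card I * card X"
proof -
  have "bij_betw (\<lambda>(R, t). rot t R) (X \<times> {0..<M}) G"
    unfolding bij_betw_def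
  proof
    show "inj_on (\<lambda>(R, t). rot t R) (X \<times> {0..<M})"
    proof (rule inj_onI, clarify)
      fix R t S s
      assume RS: "R \<in> X" "S \<in> X" and ts: "t \<in> {0..<M}" "s \<in> {0..<M}" and eq: "rot t R = rot s S"
      have "rot (- s) (rot t R) = S"
        using RS X by (subst eq) (simp add: rot_rot rot_0 subset_iff)
      then have S: "rot ((t - s) mod M) R = S" by (simp add: rot_rot rot_mod)
      have "(t - s) mod M = 0"
        using uniq[OF RS(1), of "(t - s) mod M"] S RS(2) pos_mod_bound[OF M_pos, of "t - s"]
          pos_mod_sign[OF M_pos, of "t - s"] by fastforce
      then have "t mod M = s mod M" by (simp add: mod_eq_dvd_iff dvd_eq_mod_eq_0)
      then have "t = s" using ts by simp
      then show "R = S \<and> t = s" using S RS X by (auto simp: rot_0)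
    qed
    show "(\<lambda>(R, t). rot t R) ` (X \<times> {0..<M}) = G"
    proof (intro equalityI subsetI)
      fix S assume "S \<in> (\<lambda>(R, t). rot t R) ` (X \<times> {0..<M})"
      then obtain R t where S: "S = rot t R" "R \<in> X" by auto
      then have "rot (- t) S \<in> X" using X by (auto simp: rot_rot rot_0)
      then show "S \<in> G" using G_iff[of S] S rot_prefs by blast
    next
      fix S assume "S \<in> G"
      then obtain t where t: "rot t S \<in> X" and S: "S \<in> prefs" using G_iff G by blast
      have "S = rot ((- t) mod M) (rot t S)"
        unfolding rot_mod using S by (simp add: rot_rot rot_0)
      moreover have "(- t) mod M \<in> {0..<M}" using M_pos by simp
      ultimately show "S \<in> (\<lambda>(R, t). rot t R) ` (X \<times> {0..<M})" using t by force
    qed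
  qed
  then have "card G = card (X \<times> {0..<M})" by (simp add: bij_betw_same_card)
  then show ?thesis by (simp add: card_cartesian_product M_def mult.commute)
qed

definition uncrossable :: "'a set \<Rightarrow> ('a \<Rightarrow> int) set" where
  "uncrossable F = {R \<in> prefs. \<exists>c. uncrossed F R c}"

definition first_block :: "'a set \<Rightarrow> 'a \<Rightarrow> ('a \<Rightarrow> int) set" where
  "first_block F i = {R \<in> prefs. uncrossed F R 0 \<and> (\<forall>c\<in>{1..M}. uncrossed F R c \<longrightarrow> R i < c)}"

text \<open>
  The representative of \<open>R\<close> is obtained by cutting the circle at the last uncrossed border at or before
  the spot \<open>R i\<close>.  It is unique: two different cuts would split the circle into two arcs, and each
  cut demands that \<open>R i\<close> lie in the arc that follows it.
\<close>

lemma card_uncrossable_first_block: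
  assumes F: "F \<subseteq> I" and i: "i \<in> I"
  shows "card (uncrossable F) = card I * card (first_block F i)"
proof (rule card_rot_orbits)
  fix R assume R: "R \<in> prefs"
  show "R \<in> uncrossable F \<longleftrightarrow> (\<exists>t. rot t R \<in> first_block F i)"
  proof
    assume "R \<in> uncrossable F"
    then obtain c0 where "uncrossed F R c0" by (auto simp: uncrossable_def)
    then have ne: "c0 mod M \<in> {c\<in>{0..<M}. uncrossed F R c}"
      using M_pos by (simp add: uncrossed_mod)
    have "finite {c\<in>{0..<M}. uncrossed F R c}" by (rule finite_subset[of _ "{0..<M}"]) auto
    \<comment> \<open>The last uncrossed border at or before \<open>R i\<close>, seen cyclically.\<close>
    then have "\<exists>c. is_arg_min (\<lambda>c. (R i - c) mod M) (\<lambda>c. c \<in> {c\<in>{0..<M}. uncrossed F R c}) c"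
      by (rule ex_is_arg_min_if_finite) (use ne in blast)
    then obtain c where c: "uncrossed F R c"
      and min: "\<And>d. d \<in> {0..<M} \<Longrightarrow> uncrossed F R d \<Longrightarrow> (R i - c) mod M \<le> (R i - d) mod M"
      unfolding is_arg_min_linorder by blast
    have "rot (- c) R i < d" if d: "d \<in> {1..M}" "uncrossed F (rot (- c) R) d" for d
    proof (rule ccontr)
      define r where "r = (R i - c) mod M"
      assume "\<not> rot (- c) R i < d"
      then have rd: "d \<le> r" using i by (simp add: rot_def r_def)
      have "r < M" using M_pos by (simp add: r_def)
      have "uncrossed F R ((d + c) mod M)" using d F by (simp add: uncrossed_rot uncrossed_mod)
      then have "r \<le> (R i - (d + c) mod M) mod M"
        using min[of "(d + c) mod M"] M_pos by (simp add: r_def)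
      also have "\<dots> = (r - d) mod M" unfolding r_def by (simp add: mod_simps algebra_simps)
      also have "\<dots> = r - d" using rd d \<open>r < M\<close> by (intro mod_pos_pos_trivial) auto
      finally show False using d by simp
    qed
    moreover have "uncrossed F (rot (- c) R) 0" using c F by (simp add: uncrossed_rot)
    ultimately have "rot (- c) R \<in> first_block F i" by (simp add: first_block_def rot_prefs)
    then show "\<exists>t. rot t R \<in> first_block F i" ..
  next
    assume "\<exists>t. rot t R \<in> first_block F i"
    then obtain t where "uncrossed F (rot t R) 0" by (auto simp: first_block_def)
    then show "R \<in> uncrossable F" using R F by (auto simp: uncrossable_def uncrossed_rot)
  qed
next
  fix R t assume R: "R \<in> first_block F i" and Rt: "rot t R \<in> first_block F i"
    and t: "0 < t" "t < M"
  have "uncrossed F R (M - t)"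
  proof -
    have "uncrossed F R (0 - t)"
      using Rt F by (simp add: first_block_def uncrossed_rot)
    then have "uncrossed F R ((0 - t) mod M)" by (simp only: uncrossed_mod)
    moreover have "(0 - t) mod M = (M - t) mod M" by (simp add: mod_simps)
    ultimately show ?thesis using uncrossed_mod[of F R "M - t"] by simp
  qed
  then have lt: "R i < M - t" using R t by (auto simp: first_block_def)
  have "uncrossed F (rot t R) t"
    using R F by (simp add: first_block_def uncrossed_rot)
  then have "rot t R i < t" using Rt t by (auto simp: first_block_def)
  moreover have "rot t R i = R i + t"
    using lt t i prefs_bounds[of R i] R by (simp add: rot_def first_block_def)
  ultimately show False using prefs_bounds[of R i] R i by (simp add: first_block_def)
qed (auto simp: first_block_def uncrossable_def)

definition only_block :: "'a set \<Rightarrow> 'a \<Rightarrow> ('a \<Rightarrow> int) set" where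
  "only_block F j = {R \<in> prefs. R j = 0 \<and> uncrossed F R 0 \<and> (\<forall>c\<in>{1..<M}. \<not> uncrossed F R c)}"

text \<open>
  Putting \<open>j\<close> into \<open>F\<close> only affects the border in front of \<open>R j\<close>.  So the last uncrossed border gets
  lost iff it was the only one and sits in front of \<open>R j\<close>; rotating \<open>R j\<close> to \<open>0\<close> selects one
  representative of each orbit.
\<close>

lemma card_uncrossable_insert:
  assumes F: "F \<subseteq> I" and j: "j \<in> I"
  shows "card (uncrossable F) = card (uncrossable (insert j F)) + card I * card (only_block F j)"
proof -
  have insert_iff: "uncrossed (insert j F) R c \<longleftrightarrow> uncrossed F R c \<and> \<not> M dvd R j - c" for R c
    by (auto simp: uncrossed_def)
  have "card (uncrossable F - uncrossable (insert j F)) = card I * card (only_block F j)"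
  proof (rule card_rot_orbits)
    fix R assume R: "R \<in> prefs"
    show "R \<in> uncrossable F - uncrossable (insert j F) \<longleftrightarrow> (\<exists>t. rot t R \<in> only_block F j)"
    proof
      assume *: "R \<in> uncrossable F - uncrossable (insert j F)"
      then obtain c where c: "uncrossed F R c" by (auto simp: uncrossable_def)
      have dvd: "M dvd R j - c" if "uncrossed F R c" for c
        using that * by (auto simp: uncrossable_def insert_iff)
      have "rot (- c) R j = 0" using dvd[OF c] j by (simp add: rot_def dvd_eq_mod_eq_0)
      moreover have "uncrossed F (rot (- c) R) 0" using c F by (simp add: uncrossed_rot)
      moreover have "\<not> uncrossed F (rot (- c) R) d" if d: "d \<in> {1..<M}" for d
      proof
        assume "uncrossed F (rot (- c) R) d"
        then have "M dvd R j - (d + c)" using F dvd by (simp add: uncrossed_rot)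
        with dvd[OF c] have "M dvd (R j - c) - (R j - (d + c))" by (rule dvd_diff)
        then have "M dvd d" by simp
        then show False using d zdvd_not_zless[of d M] by auto
      qed
      ultimately have "rot (- c) R \<in> only_block F j" by (simp add: only_block_def rot_prefs)
      then show "\<exists>t. rot t R \<in> only_block F j" ..
    next
      assume "\<exists>t. rot t R \<in> only_block F j"
      then obtain t where "rot t R \<in> only_block F j" ..
      then have t: "(R j + t) mod M = 0" "uncrossed F (rot t R) 0"
        "\<And>c. c \<in> {1..<M} \<Longrightarrow> \<not> uncrossed F (rot t R) c"
        using j by (simp_all add: only_block_def) (simp add: rot_def)
      have "M dvd R j - c" if "uncrossed F R c" for c
      proof -
        have u: "uncrossed F (rot t R) ((c + t) mod M)"
          using that F by (simp add: uncrossed_mod) (simp add: uncrossed_rot)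
        have "(c + t) mod M = 0"
        proof (rule ccontr)
          assume "(c + t) mod M \<noteq> 0"
          then have "(c + t) mod M \<in> {1..<M}"
            using pos_mod_sign[OF M_pos, of "c + t"] pos_mod_bound[OF M_pos, of "c + t"] by auto
          then show False using t(3) u by blast
        qed
        then have "M dvd (R j + t) - (c + t)" using t(1) by (intro dvd_diff) (auto simp: dvd_eq_mod_eq_0)
        then show ?thesis by simp
      qed
      then show "R \<in> uncrossable F - uncrossable (insert j F)"
        using R F t(2) by (auto simp: uncrossable_def insert_iff uncrossed_rot)
    qed
  next
    fix R t assume "R \<in> only_block F j" "rot t R \<in> only_block F j" "0 < t" "t < M"
    then show False using j by (simp add: only_block_def rot_def)
  qed (auto simp: only_block_def uncrossable_def)
  moreover have "uncrossable (insert j F) \<subseteq> uncrossable F"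
    by (auto simp: uncrossable_def insert_iff)
  moreover have "finite (uncrossable F)" using finite_prefs by (simp add: uncrossable_def)
  ultimately show ?thesis
    by (metis card_Diff_subset card_mono finite_subset le_add_diff_inverse)
qed

end

section \<open>Parking functions and the number of preferences with an uncrossed border\<close>

definition parking_functions :: "'a set \<Rightarrow> ('a \<Rightarrow> int) set" where
  "parking_functions J = {Q \<in> J \<rightarrow>\<^sub>E {0..<int (card J)}.
     \<forall>c\<in>{1..int (card J)}. c \<le> int (card {i\<in>J. Q i < c})}"

lemma card_parking_functions_le:
  assumes h: "bij_betw h J K" and fin: "finite K"
  shows "card (parking_functions K) \<le> card (parking_functions J)"
proof -
  have JK: "card J = card K" using h by (rule bij_betw_same_card)
  have "inj_on (\<lambda>Q. \<lambda>i\<in>J. Q (h i)) (parking_functions K)"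
  proof (rule inj_onI)
    fix P Q assume PQ: "P \<in> parking_functions K" "Q \<in> parking_functions K"
      and eq: "(\<lambda>i\<in>J. P (h i)) = (\<lambda>i\<in>J. Q (h i))"
    have "P k = Q k" if k: "k \<in> K" for k
    proof -
      obtain i where "i \<in> J" "k = h i" using k bij_betw_imp_surj_on[OF h] by blast
      then show ?thesis using fun_cong[OF eq, of i] by simp
    qed
    then show "P = Q" using PQ by (auto simp: parking_functions_def intro: PiE_ext)
  qed
  moreover have "(\<lambda>i\<in>J. Q (h i)) \<in> parking_functions J" if Q: "Q \<in> parking_functions K" for Q
  proof -
    have "card {i\<in>J. (\<lambda>i\<in>J. Q (h i)) i < c} = card {k\<in>K. Q k < c}" for c
    proof (rule bij_betw_same_card)
      show "bij_betw h {i\<in>J. (\<lambda>i\<in>J. Q (h i)) i < c} {k\<in>K. Q k < c}"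
        using h by (auto simp: bij_betw_def inj_on_def)
    qed
    then show ?thesis using Q h by (auto simp: parking_functions_def JK bij_betw_def)
  qed
  moreover have "finite (parking_functions J)"
  proof -
    have "finite J" using h fin bij_betw_finite by blast
    then show ?thesis unfolding parking_functions_def
      by (intro finite_subset[OF _ finite_PiE[of J "\<lambda>_. {0..<int (card J)}"]]) auto
  qed
  ultimately show ?thesis by (intro card_inj_on_le) auto
qed

lemma card_parking_functions_cong:
  assumes "finite J" "finite K" "card J = card K"
  shows "card (parking_functions J) = card (parking_functions K)"
proof -
  obtain h where h: "bij_betw h J K" using assms finite_same_card_bij by blast
  show ?thesis
    using card_parking_functions_le[OF h assms(2)]
      card_parking_functions_le[OF bij_betw_inv_into[OF h] assms(1)] by simp
qed

context parking_circle
begin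

text \<open>
  Take car \<open>j\<close> out and let every car of \<open>F\<close> start at the spot it comes from.  With \<open>q\<close> denoting the
  number of all cars, \<open>j\<close> included, that start before \<open>c\<close>, the border in front of \<open>c \<in> {1..<M}\<close> is
  crossed iff \<open>q > c\<close>, that is, iff at least \<open>c\<close> of the other cars start before \<open>c\<close>.  This is the
  condition for a parking function of \<open>M - 1\<close> cars, and it does not mention \<open>F\<close>.
\<close>

lemma card_only_block:
  assumes F: "F \<subseteq> I" and j: "j \<in> I" "j \<notin> F"
  shows "card (only_block F j) = card (parking_functions (I - {j}))"
proof (rule bij_betw_same_card)
  let ?J = "I - {j}"
  let ?Q = "\<lambda>R. \<lambda>i\<in>?J. R i - of_bool (i \<in> F)"
  let ?R = "\<lambda>Q. \<lambda>i\<in>I. if i = j then 0 else Q i + of_bool (i \<in> F)"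
  have cJ: "int (card ?J) = M - 1"
    using j M_pos by (simp add: M_def of_nat_diff)
  have split: "card {i\<in>I. R i - of_bool (i \<in> F) < c} = Suc (card {i\<in>?J. ?Q R i < c})"
    if "R j = 0" "1 \<le> c" for R :: "'a \<Rightarrow> int" and c
  proof -
    have "{i\<in>I. R i - of_bool (i \<in> F) < c} = insert j {i\<in>?J. ?Q R i < c}"
      using that j by auto
    then show ?thesis using finite_I by simp
  qed
  have le: "card {i\<in>I. R i < c} \<le> card {i\<in>I. R i - of_bool (i \<in> F) < c}" for R :: "'a \<Rightarrow> int" and c
    using finite_I by (intro card_mono) auto
  have to: "?Q R \<in> parking_functions ?J" if RZ: "R \<in> only_block F j" for R
  proof -
    have R: "R \<in> prefs" and Rj: "R j = 0" and u0: "uncrossed F R 0"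
      and only: "\<And>c. c \<in> {1..<M} \<Longrightarrow> \<not> uncrossed F R c" using RZ by (auto simp: only_block_def)
    have park: "\<And>c. c \<in> {1..M} \<Longrightarrow> c \<le> int (card {i\<in>I. R i < c})" and F0: "\<And>i. i \<in> F \<Longrightarrow> R i \<noteq> 0"
      using u0 uncrossed_0_iff[OF R F] by auto
    have *: "c \<le> int (card {i\<in>?J. ?Q R i < c})" if c: "c \<in> {1..int (card ?J)}" for c
    proof (rule ccontr)
      assume "\<not> ?thesis"
      then have lt: "int (card {i\<in>I. R i - of_bool (i \<in> F) < c}) \<le> c"
        using split[of R c, OF Rj] c by simp
      have c': "c \<in> {1..<M}" using c cJ by simp
      then have ge: "c \<le> int (card {i\<in>I. R i < c})" using park by simp
      have eq: "{i\<in>I. R i < c} = {i\<in>I. R i - of_bool (i \<in> F) < c}"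
        using finite_I lt ge le[of R c] by (intro card_subset_eq) auto
      then have "R i \<noteq> c" if "i \<in> F" for i using that F by (auto simp: set_eq_iff)
      moreover have "int (card {i\<in>I. R i < c}) = c" using ge lt le[of R c] by simp
      ultimately have "uncrossed F R c" using uncrossed_iff_tight[OF R F u0, of c] c' by simp
      then show False using only c' by blast
    qed
    have "?Q R i \<in> {0..<M - 1}" if i: "i \<in> ?J" for i
    proof -
      have "0 \<le> ?Q R i" using prefs_bounds[OF R, of i] F0[of i] i by (auto simp: less_le)
      moreover have "?Q R i < M - 1"
      proof (cases "M = 1")
        case True
        then have "?J = {}" using cJ finite_I by (simp del: Diff_eq_empty_iff)
        then show ?thesis using i by blast
      next
        case False
        then have "M - 1 \<le> int (card {i\<in>?J. ?Q R i < M - 1})" using *[of "M - 1"] cJ M_pos by simp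
        then have "{i\<in>?J. ?Q R i < M - 1} = ?J"
          using cJ finite_I by (intro card_seteq) auto
        then show ?thesis using i by blast
      qed
      ultimately show ?thesis by simp
    qed
    then show ?thesis using * by (auto simp: parking_functions_def cJ)
  qed
  have inv: "?Q (?R Q) = Q" if Q: "Q \<in> parking_functions ?J" for Q
  proof
    fix i
    have "Q i = undefined" if "i \<notin> ?J" using Q that unfolding parking_functions_def by blast
    then show "?Q (?R Q) i = Q i" by simp
  qed
  have fro: "?R Q \<in> only_block F j" if Q: "Q \<in> parking_functions ?J" for Q
  proof -
    have "Q \<in> ?J \<rightarrow>\<^sub>E {0..<M - 1}" using Q unfolding parking_functions_def cJ by blast
    from PiE_mem[OF this] have b: "0 \<le> Q i \<and> Q i < M - 1" if "i \<in> ?J" for i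
      using that by (simp only: atLeastLessThan_iff)
    define S where "S = ?R Q"
    have S_apply: "S i = (if i = j then 0 else Q i + of_bool (i \<in> F))" if "i \<in> I" for i
      using that by (simp add: S_def)
    have R: "S \<in> prefs"
    proof -
      have "S i \<in> {0..<M}" if "i \<in> I" for i
        using b[of i] M_pos that by (cases "i = j") (auto simp: S_apply)
      then show ?thesis unfolding prefs_def by (intro PiE_I) (auto simp: S_def)
    qed
    have RJ: "S j = 0" using j by (simp add: S_apply)
    have park: "c \<le> int (card {i\<in>?J. Q i < c})" if "c \<in> {1..M - 1}" for c
      using Q that by (simp add: parking_functions_def cJ)
    have sp: "card {i\<in>I. S i - of_bool (i \<in> F) < c} = Suc (card {i\<in>?J. Q i < c})"
      if "1 \<le> c" for c
      using split[of S c, OF RJ that] unfolding S_def inv[OF Q] .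
    have u0: "uncrossed F S 0"
      unfolding uncrossed_0_iff[OF R F]
    proof (intro conjI ballI)
      fix c assume c: "c \<in> {1..M}"
      \<comment> \<open>Whoever starts before \<open>c - 1\<close> prefers a spot before \<open>c\<close>, even in \<open>F\<close>; car \<open>j\<close> adds one more.\<close>
      have "c \<le> 1 + int (card {i\<in>?J. Q i < c - 1})"
        using park[of "c - 1"] c by (cases "c = 1") auto
      also have "\<dots> = int (card (insert j {i\<in>?J. Q i < c - 1}))" using finite_I by simp
      also have "\<dots> \<le> int (card {i\<in>I. S i < c})"
        using finite_I c j by (intro of_nat_mono card_mono) (auto simp: S_apply)
      finally show "c \<le> int (card {i\<in>I. S i < c})" .
    next
      fix i assume "i \<in> F"
      then have "i \<in> I" "i \<in> ?J" using F j by blast+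
      then show "S i \<noteq> 0" using b[of i] \<open>i \<in> F\<close> by (auto simp: S_apply)
    qed
    have only: "\<not> uncrossed F S c" if c: "c \<in> {1..<M}" for c
    proof
      assume "uncrossed F S c"
      then have t: "int (card {i\<in>I. S i < c}) = c" "\<And>i. i \<in> F \<Longrightarrow> S i \<noteq> c"
        using uncrossed_iff_tight[OF R F u0, of c] c by auto
      have "S i < c" if "i \<in> I" "S i - of_bool (i \<in> F) < c" for i
        using t(2)[of i] that by (cases "i \<in> F") auto
      then have "{i\<in>I. S i - of_bool (i \<in> F) < c} = {i\<in>I. S i < c}" by auto
      then have "int (Suc (card {i\<in>?J. Q i < c})) = c" using sp[of c] c t(1) by simp
      then show False using park[of c] c by simp
    qed
    show "?R Q \<in> only_block F j" using R RJ u0 only unfolding only_block_def S_def by blast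
  qed
  have inv2: "?R (?Q R) = R" if "R \<in> only_block F j" for R
  proof
    fix i
    have "R j = 0" "i \<notin> I \<Longrightarrow> R i = undefined"
      using that unfolding only_block_def prefs_def by blast+
    then show "?R (?Q R) i = R i" by simp
  qed
  show "bij_betw ?Q (only_block F j) (parking_functions ?J)"
    by (rule bij_betw_byWitness[where f' = ?R]) (use to fro inv inv2 in auto)
qed

lemma uncrossable_empty: "uncrossable {} = prefs"
  using exists_uncrossed_empty by (auto simp: uncrossable_def)

text \<open>
  Behind an uncrossed border there must be a car preferring the very next spot, since nobody else
  can fill it; a car of \<open>F\<close> would have crossed the border.
\<close>

lemma uncrossable_all: "uncrossable I = {}"
proof -
  have False if R: "R \<in> prefs" and c: "uncrossed I R c" for R c
  proof -
    let ?S = "rot (- c) R"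
    have "uncrossed I ?S 0" using c by (simp add: uncrossed_rot)
    then have "1 \<le> int (card {i\<in>I. ?S i < 1})" and ne: "\<forall>i\<in>I. ?S i \<noteq> 0"
      using uncrossed_0_iff[OF rot_prefs, of I "- c" R] M_pos by (auto dest: bspec[where x = 1])
    then have "{i\<in>I. ?S i < 1} \<noteq> {}" by force
    then obtain i where "i \<in> I" "?S i < 1" by blast
    then show False using ne prefs_bounds[OF rot_prefs, of i "- c" R] by (auto simp: less_le)
  qed
  then show ?thesis by (auto simp: uncrossable_def)
qed

text \<open>
  By the preceding lemmas each new element of \<open>F\<close> costs the same number \<open>card I * p\<close>, where \<open>p\<close>
  counts parking functions.  The value of \<open>p\<close> results from the case \<open>F = I\<close>, where nothing is left.
  Both sides carry a factor \<open>card I\<close> in order to avoid the truncated exponent \<open>card I - 1\<close>.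
\<close>

lemma card_uncrossable:
  assumes "F \<subseteq> I"
  shows "card (uncrossable F) * card I = (card I - card F) * card I ^ card I"
proof -
  obtain i0 where i0: "i0 \<in> I" using nonempty_I by blast
  define p where "p = card (parking_functions (I - {i0}))"
  have p: "card (parking_functions (I - {j})) = p" if "j \<in> I" for j
    unfolding p_def using that i0 finite_I by (intro card_parking_functions_cong) auto
  have step: "card (uncrossable F) + card F * (card I * p) = card I ^ card I" if "F \<subseteq> I" for F
    using finite_subset[OF that finite_I] that
  proof (induction F rule: finite_induct)
    case empty
    then show ?case by (simp add: uncrossable_empty card_prefs)
  next
    case (insert j F)
    then show ?case
      using card_uncrossable_insert[of F j] card_only_block[of F j] p[of j] by (simp add: algebra_simps)
  qed
  have all: "card I * (card I * p) = card I ^ card I"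
    using step[of I] by (simp add: uncrossable_all)
  obtain k where k: "card I = card F + k"
    using card_mono[OF finite_I assms] le_Suc_ex by blast
  have "card (uncrossable F) + card F * (card I * p) = card F * (card I * p) + k * (card I * p)"
    using step[OF assms] all by (metis k add_mult_distrib)
  then have "card (uncrossable F) * card I = k * (card I * (card I * p))" by simp
  then show ?thesis unfolding all using k by simp
qed

lemma card_first_block:
  assumes "F \<subseteq> I" "i \<in> I" "2 \<le> card I"
  shows "card (first_block F i) = (card I - card F) * card I ^ (card I - 2)"
proof -
  obtain k where k: "card I = Suc (Suc k)" using assms(3) by (metis add_2_eq_Suc le_Suc_ex)
  have "card I * (card I * card (first_block F i)) =
      card I * (card I * ((card I - card F) * card I ^ k))"
    using card_uncrossable[OF assms(1)] card_uncrossable_first_block[OF assms(1,2)]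
    by (simp add: k del: mult_Suc mult_Suc_right)
  then show ?thesis by (simp add: k del: mult_Suc mult_Suc_right)
qed

end

section \<open>Monomials in monomial ideals\<close>

lemma Var_power: "Var i ^ k = (Poly_Mapping.single (Poly_Mapping.single i k) 1 :: 'k::field mpoly)"
proof (induction k)
  case (Suc k)
  have "Poly_Mapping.single i (1::nat) + Poly_Mapping.single i k = Poly_Mapping.single i (Suc k)"
    by (simp add: Poly_Mapping.single_add[symmetric])
  then show ?case using Suc by (simp add: Var_def mult_single)
qed simp

lemma prod_Var_power:
  "finite A \<Longrightarrow> (\<Prod>i\<in>A. Var i ^ f i) =
    (Poly_Mapping.single (\<Sum>i\<in>A. Poly_Mapping.single i (f i)) 1 :: 'k::field mpoly)"
  by (induction A rule: finite_induct) (simp_all add: Var_power mult_single)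

lemma lookup_exponent:
  assumes "finite A"
  shows "Poly_Mapping.lookup (\<Sum>i\<in>A. Poly_Mapping.single i (f i)) j = (if j \<in> A then f j else (0::nat))"
  using assms by (simp add: lookup_sum lookup_single when_def)

lemma keys_exponent:
  assumes "finite A"
  shows "Poly_Mapping.keys (\<Sum>i\<in>A. Poly_Mapping.single i (f i :: nat)) \<subseteq> A"
  using lookup_exponent[OF assms, of f] by (auto simp: in_keys_iff split: if_splits)

lemma monomial_in_poly_ring:
  assumes "A \<subseteq> {1..n}"
  shows "(\<Prod>i\<in>A. Var i ^ f i :: 'k::field mpoly) \<in> carrier (poly_ring n)"
proof -
  have "finite A" using assms finite_subset by blast
  then show ?thesis
    using keys_exponent[of A f] assms by (auto simp: prod_Var_power poly_ring_def)
qed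

text \<open>
  This bounds the ideal generated by some monomials from above: \<open>D\<close> will consist of the exponents of
  all their multiples.
\<close>

lemma ideal_of_keys:
  fixes D :: "(nat \<Rightarrow>\<^sub>0 nat) set"
  assumes up: "\<And>s t. t \<in> D \<Longrightarrow> s + t \<in> D"
  shows "ideal {p \<in> carrier (poly_ring n :: 'k::field mpoly ring). Poly_Mapping.keys p \<subseteq> D} (poly_ring n)"
    (is "ideal ?J ?P")
proof -
  interpret P: cring ?P by (rule cring_poly_ring)
  have mult: "x * a \<in> ?J" if "x \<in> carrier ?P" "a \<in> ?J" for x a
  proof -
    have "Poly_Mapping.keys (x * a) \<subseteq> D" using keys_mult[of x a] that up by blast
    moreover have "x * a \<in> carrier ?P" using P.m_closed[of x a] that by simp
    ultimately show ?thesis by simp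
  qed
  show ?thesis
  proof (rule idealI)
    show "subgroup ?J (add_monoid ?P)"
    proof (rule P.add.subgroupI)
      show "?J \<noteq> {}" using P.zero_closed by force
      fix a assume a: "a \<in> ?J"
      have "- a \<in> carrier ?P" using a by (simp add: poly_ring_def)
      moreover from this have "\<ominus>\<^bsub>?P\<^esub> a = - a" using a by (intro P.minus_equality) auto
      ultimately show "\<ominus>\<^bsub>?P\<^esub> a \<in> ?J" using a by simp
    next
      fix a b assume ab: "a \<in> ?J" "b \<in> ?J"
      then have "Poly_Mapping.keys (a + b) \<subseteq> D" using keys_add[of a b] by blast
      moreover have "a + b \<in> carrier ?P" using P.a_closed[of a b] ab by simp
      ultimately show "a \<oplus>\<^bsub>?P\<^esub> b \<in> ?J" by simp
    qed auto
    fix a x assume ax: "a \<in> ?J" "x \<in> carrier ?P"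
    show "x \<otimes>\<^bsub>?P\<^esub> a \<in> ?J" using mult[OF ax(2,1)] by simp
    show "a \<otimes>\<^bsub>?P\<^esub> x \<in> ?J" using mult[OF ax(2,1)] by (simp add: mult.commute)
  qed (rule P.ring_axioms)
qed

lemma monomial_in_ideal_iff:
  assumes S: "\<And>A. A \<in> S \<Longrightarrow> A \<subseteq> {1..n}"
  shows "(\<Prod>i\<in>{1..n}. Var i ^ P i :: 'k::field mpoly)
      \<in> Idl\<^bsub>poly_ring n\<^esub> {\<Prod>i\<in>A. Var i ^ d A i | A. A \<in> S}
    \<longleftrightarrow> (\<exists>A\<in>S. \<forall>i\<in>A. d A i \<le> P i)" (is "?x \<in> Idl\<^bsub>?P\<^esub> ?G \<longleftrightarrow> _")
proof
  interpret P: cring ?P by (rule cring_poly_ring)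
  have fin: "finite A" if "A \<in> S" for A using S[OF that] finite_subset by blast
  have G: "?G \<subseteq> carrier ?P" using S monomial_in_poly_ring by blast
  {
    define D where "D = {t. \<exists>A\<in>S. \<forall>i\<in>A. d A i \<le> Poly_Mapping.lookup t i}"
    let ?J = "{p \<in> carrier (poly_ring n :: 'k mpoly ring). Poly_Mapping.keys p \<subseteq> D}"
    have "ideal ?J ?P"
    proof (rule ideal_of_keys)
      fix s t assume "t \<in> D"
      then obtain A where "A \<in> S" "\<And>i. i \<in> A \<Longrightarrow> d A i \<le> Poly_Mapping.lookup t i"
        unfolding D_def by blast
      then show "s + t \<in> D"
        unfolding D_def by (auto simp: lookup_add intro!: bexI[of _ A] trans_le_add2)
    qed
    moreover have "?G \<subseteq> ?J"
    proof
      fix x assume "x \<in> ?G"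
      then obtain A where A: "A \<in> S" "x = (\<Prod>i\<in>A. Var i ^ d A i)" by auto
      then have "Poly_Mapping.keys x \<subseteq> D"
        using fin by (auto simp: prod_Var_power D_def lookup_exponent intro!: bexI[of _ A])
      then show "x \<in> ?J" using A S monomial_in_poly_ring by blast
    qed
    ultimately have "Idl\<^bsub>?P\<^esub> ?G \<subseteq> ?J" by (rule P.genideal_minimal)
    moreover assume "?x \<in> Idl\<^bsub>?P\<^esub> ?G"
    ultimately have "(\<Sum>i\<in>{1..n}. Poly_Mapping.single i (P i)) \<in> D"
      by (auto simp: prod_Var_power)
    then obtain A where A: "A \<in> S"
        "\<forall>i\<in>A. d A i \<le> Poly_Mapping.lookup (\<Sum>i\<in>{1..n}. Poly_Mapping.single i (P i)) i"
      unfolding D_def by blast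
    have "d A i \<le> P i" if "i \<in> A" for i
      using A(2) S[OF A(1)] that by (auto simp: lookup_exponent subset_iff)
    then show "\<exists>A\<in>S. \<forall>i\<in>A. d A i \<le> P i" using A(1) by blast
  next
    assume "\<exists>A\<in>S. \<forall>i\<in>A. d A i \<le> P i"
    then obtain A where A: "A \<in> S" and le: "\<And>i. i \<in> A \<Longrightarrow> d A i \<le> P i" by blast
    let ?q = "\<Prod>i\<in>{1..n}. Var i ^ (P i - (if i \<in> A then d A i else 0)) :: 'k mpoly"
    have "(\<Prod>i\<in>A. Var i ^ d A i) = (\<Prod>i\<in>{1..n}. Var i ^ (if i \<in> A then d A i else 0) :: 'k mpoly)"
      using S[OF A] by (intro prod.mono_neutral_cong_left) auto
    then have "?q * (\<Prod>i\<in>A. Var i ^ d A i) = ?x"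
      using le by (simp add: prod.distrib[symmetric] power_add[symmetric])
    moreover have "(\<Prod>i\<in>A. Var i ^ d A i) \<in> Idl\<^bsub>?P\<^esub> ?G"
      using P.genideal_self[OF G] A by blast
    then have "?q \<otimes>\<^bsub>?P\<^esub> (\<Prod>i\<in>A. Var i ^ d A i) \<in> Idl\<^bsub>?P\<^esub> ?G"
      by (rule ideal.I_l_closed[OF P.genideal_ideal[OF G]]) (rule monomial_in_poly_ring, simp)
    ultimately show "?x \<in> Idl\<^bsub>?P\<^esub> ?G" by simp
  }
qed

section \<open>Spherical parking functions as an inequality condition\<close>

lemma out_deg_eq_card:
  assumes "i \<in> A"
  shows "out_deg n E A i = card {j \<in> {0..n} - A. {i, j} \<in> E}"
proof -
  have "{e \<in> E. \<exists>j\<in>{0..n} - A. e = {i, j}} = (\<lambda>j. {i, j}) ` {j \<in> {0..n} - A. {i, j} \<in> E}" by auto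
  moreover have "inj_on (\<lambda>j. {i, j}) {j \<in> {0..n} - A. {i, j} \<in> E}"
    using assms by (auto simp: inj_on_def doubleton_eq_iff)
  ultimately show ?thesis by (simp add: out_deg_def card_image)
qed

text \<open>
  The skeleton ideal lacks only the generator for \<open>A = {1..n}\<close>, which is \<open>x\<^sub>1 \<cdots> x\<^sub>n\<close> when every vertex is
  joined to the root.  So a monomial in the difference has to be a multiple of that generator.
\<close>

lemma sPF_iff:
  assumes out1: "\<And>i. i \<in> {1..n} \<Longrightarrow> out_deg n E {1..n} i = 1" and n: "1 \<le> n"
  shows "P \<in> sPF TYPE('k::field) n E \<longleftrightarrow> P \<in> {1..n} \<rightarrow>\<^sub>E UNIV \<and> (\<forall>i\<in>{1..n}. 1 \<le> P i) \<and>
    (\<forall>A. A \<noteq> {} \<and> A \<subset> {1..n} \<longrightarrow> (\<exists>i\<in>A. P i < out_deg n E A i))"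
proof -
  have proper: "A \<subset> {1..n} \<longleftrightarrow> A \<subseteq> {1..n} \<and> card A \<le> n - 1" for A
  proof
    assume "A \<subset> {1..n}"
    then show "A \<subseteq> {1..n} \<and> card A \<le> n - 1" using psubset_card_mono[of "{1..n}" A] by auto
  next
    assume "A \<subseteq> {1..n} \<and> card A \<le> n - 1"
    then show "A \<subset> {1..n}" using n by auto
  qed
  have all: "(\<Prod>i\<in>{1..n}. Var i ^ P i :: 'k mpoly) \<in> parking_ideal n E \<longleftrightarrow>
      (\<exists>A\<in>{A. A \<noteq> {} \<and> A \<subseteq> {1..n}}. \<forall>i\<in>A. out_deg n E A i \<le> P i)"
    using monomial_in_ideal_iff[of "{A. A \<noteq> {} \<and> A \<subseteq> {1..n}}" n P "out_deg n E"]
    by (simp add: parking_ideal_def cut_monomial_def)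
  have skel: "(\<Prod>i\<in>{1..n}. Var i ^ P i :: 'k mpoly) \<in> skeleton_ideal n E \<longleftrightarrow>
      (\<exists>A\<in>{A. A \<noteq> {} \<and> A \<subset> {1..n}}. \<forall>i\<in>A. out_deg n E A i \<le> P i)"
    using monomial_in_ideal_iff[of "{A. A \<noteq> {} \<and> A \<subset> {1..n}}" n P "out_deg n E"]
    unfolding proper by (simp add: skeleton_ideal_def cut_monomial_def)
  have ne: "{1..n} \<noteq> {}" using n by simp
  have "(\<exists>A\<in>{A. A \<noteq> {} \<and> A \<subseteq> {1..n}}. \<forall>i\<in>A. out_deg n E A i \<le> P i) \<longleftrightarrow>
      (\<exists>A\<in>{A. A \<noteq> {} \<and> A \<subset> {1..n}}. \<forall>i\<in>A. out_deg n E A i \<le> P i) \<or> (\<forall>i\<in>{1..n}. 1 \<le> P i)"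
    (is "?L \<longleftrightarrow> ?R")
  proof
    assume ?L
    then obtain A where A: "A \<noteq> {}" "A \<subseteq> {1..n}" "\<forall>i\<in>A. out_deg n E A i \<le> P i" by blast
    show ?R
    proof (cases "A = {1..n}")
      case True then show ?thesis using A(3) out1 by simp
    next
      case False then show ?thesis using A by blast
    qed
  next
    assume ?R
    then show ?L
    proof
      assume "\<forall>i\<in>{1..n}. 1 \<le> P i"
      then show ?L using ne out1 by (intro bexI[of _ "{1..n}"]) auto
    qed blast
  qed
  then have "(\<Prod>i\<in>{1..n}. Var i ^ P i :: 'k mpoly) \<in> parking_ideal n E - skeleton_ideal n E \<longleftrightarrow>
      (\<forall>i\<in>{1..n}. 1 \<le> P i) \<and>
      \<not> (\<exists>A\<in>{A. A \<noteq> {} \<and> A \<subset> {1..n}}. \<forall>i\<in>A. out_deg n E A i \<le> P i)"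
    unfolding Diff_iff all skel by blast
  also have "\<dots> \<longleftrightarrow> (\<forall>i\<in>{1..n}. 1 \<le> P i) \<and>
    (\<forall>A. A \<noteq> {} \<and> A \<subset> {1..n} \<longrightarrow> (\<exists>i\<in>A. P i < out_deg n E A i))"
    by (auto simp: not_le)
  finally show ?thesis by (simp add: sPF_def)
qed

lemma edge_G_iff:
  "{i, j} \<in> G_edges n l \<longleftrightarrow> i \<le> n \<and> j \<le> n \<and> i \<noteq> j \<and>
    \<not> (i = 1 \<and> j \<in> {n - l + 1..n}) \<and> \<not> (j = 1 \<and> i \<in> {n - l + 1..n})"
  unfolding G_edges_def complete_edges_def by (auto simp: doubleton_eq_iff)

section \<open>The complete graph with a star removed\<close>

lemma card_split_threshold:
  fixes f :: "'a \<Rightarrow> 'b::linorder"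
  assumes "finite X"
  shows "card X = card {x\<in>X. c \<le> f x} + card {x\<in>X. f x < c}"
proof -
  have "X = {x\<in>X. c \<le> f x} \<union> {x\<in>X. f x < c}" by auto
  moreover have "card ({x\<in>X. c \<le> f x} \<union> {x\<in>X. f x < c}) =
      card {x\<in>X. c \<le> f x} + card {x\<in>X. f x < c}"
    using assms by (intro card_Un_disjoint) auto
  ultimately show ?thesis by simp
qed

context
  fixes n l :: nat
  assumes n: "3 \<le> n" and l: "l \<le> n - 2"
begin

abbreviation (input) "far \<equiv> {n - l + 1..n}"
abbreviation (input) "near \<equiv> {2..n - l}"

lemma out_deg_1:
  assumes "1 \<in> A" "A \<subseteq> {1..n}"
  shows "out_deg n (G_edges n l) A 1 = Suc (card (near - A))"
proof -
  have "{j \<in> {0..n} - A. {1, j} \<in> G_edges n l} = insert 0 (near - A)"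
  proof (intro equalityI subsetI)
    fix j assume j: "j \<in> {j \<in> {0..n} - A. {1, j} \<in> G_edges n l}"
    then have "j \<noteq> 1" "j < n - l + 1" using assms unfolding edge_G_iff by auto
    then show "j \<in> insert 0 (near - A)" using j by auto
  next
    fix j assume "j \<in> insert 0 (near - A)"
    then show "j \<in> {j \<in> {0..n} - A. {1, j} \<in> G_edges n l}"
      using assms n l unfolding edge_G_iff by auto
  qed
  then show ?thesis using assms by (simp add: out_deg_eq_card)
qed

lemma out_deg_other:
  assumes "i \<in> A" "A \<subseteq> {1..n}" "i \<noteq> 1"
  shows "int (out_deg n (G_edges n l) A i) =
    int n + 1 - int (card A) - of_bool (i \<in> far \<and> 1 \<notin> A)"
proof -
  have fin: "finite A" using assms finite_subset by blast
  have c: "int (card ({0..n} - A)) = int n + 1 - int (card A)"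
  proof -
    have "A \<subseteq> {0..n}" using assms by auto
    then have "card A \<le> card {0..n}" by (intro card_mono) auto
    then show ?thesis using fin \<open>A \<subseteq> {0..n}\<close> by (subst card_Diff_subset) auto
  qed
  have set: "{j \<in> {0..n} - A. {i, j} \<in> G_edges n l} = {0..n} - A - (if i \<in> far then {1} else {})"
    using assms unfolding edge_G_iff by auto
  have "int (card ({0..n} - A - {1})) = int (card ({0..n} - A)) - of_bool (1 \<notin> A)"
  proof (cases "1 \<in> A")
    case False
    then have "1 \<in> {0..n} - A" using n by simp
    then have "card ({0..n} - A) = Suc (card ({0..n} - A - {1}))" by (intro card.remove) auto
    then show ?thesis using False by simp
  qed simp
  then show ?thesis using c set assms(1)
    by (cases "i \<in> far")
      (simp_all only: out_deg_eq_card if_True if_False Diff_empty simp_thms of_bool_def)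
qed

text \<open>
  The preferences of the cars \<open>2, \<dots>, n\<close>: the edge to the root takes \<open>1\<close> off each value, and a vertex in
  \<open>far\<close> gets it back, as it has one edge less into the complement of \<open>A\<close> whenever \<open>1 \<notin> A\<close>.
\<close>

definition shifted :: "(nat \<Rightarrow> nat) \<Rightarrow> nat \<Rightarrow> int" where
  "shifted P = (\<lambda>i\<in>{2..n}. int (P i) - 1 + of_bool (i \<in> far))"

definition unshifted :: "(nat \<Rightarrow> int) \<Rightarrow> nat \<Rightarrow> nat \<Rightarrow> nat" where
  "unshifted R p = (\<lambda>i\<in>{1..n}. if i = 1 then p else nat (R i + 1 - of_bool (i \<in> far)))"

lemma shifted_apply: "i \<in> {2..n} \<Longrightarrow> shifted P i = int (P i) - 1 + of_bool (i \<in> far)"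
  by (simp add: shifted_def)

lemma unshifted_apply:
  "i \<in> {2..n} \<Longrightarrow> unshifted R p i = nat (R i + 1 - of_bool (i \<in> far))"
  by (simp add: unshifted_def)

lemma unshifted_1: "unshifted R p 1 = p"
  using n by (simp add: unshifted_def)

interpretation parking_circle "{2..n}"
  using n by unfold_locales auto

lemma M_eq: "M = int n - 1"
  using n by (simp add: M_def)

text \<open>
  Only extremal sets \<open>A\<close> matter.  Among the sets of a given size not containing \<open>1\<close>, the strongest
  condition comes from the cars with the largest preferences; it bounds the number of cars
  preferring a spot before \<open>c\<close> from below by \<open>c\<close>.  If \<open>1 \<in> A\<close>, then the cars of \<open>far\<close> lose no edge, and
  what counts is the spot where they start.  All cars of \<open>A\<close> can then violate the inequality
  only if they are exactly the \<open>M - c\<close> cars behind an uncrossed border \<open>c\<close>; in that case vertex \<open>1\<close>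
  itself has to satisfy it, so \<open>P 1\<close> is at most the number of its neighbours in front of \<open>c\<close>.
\<close>

lemma sPF_G_iff:
  assumes ext: "P \<in> {1..n} \<rightarrow>\<^sub>E UNIV"
  shows "P \<in> sPF TYPE('k::field) n (G_edges n l) \<longleftrightarrow>
    (\<forall>i\<in>{1..n}. 1 \<le> P i) \<and> shifted P \<in> prefs \<and> uncrossed far (shifted P) 0 \<and>
    (\<forall>c\<in>{1..M}. uncrossed far (shifted P) c \<longrightarrow> P 1 \<le> card {i \<in> near. shifted P i < c})"
    (is "_ \<longleftrightarrow> ?pos \<and> _ \<and> _ \<and> _")
proof -
  define R where "R = shifted P"
  let ?d = "out_deg n (G_edges n l)"
  have far: "far \<subseteq> {2..n}" and nl: "n - l \<le> n" using n l by auto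
  let ?first = "\<forall>c\<in>{1..M}. uncrossed far R c \<longrightarrow> P 1 \<le> card {i \<in> near. R i < c}"
  have R_apply: "R i = int (P i) - 1 + of_bool (i \<in> far)" if "i \<in> {2..n}" for i
    using that unfolding R_def by (rule shifted_apply)
  have out1: "?d {1..n} i = 1" if "i \<in> {1..n}" for i
  proof (cases "i = 1")
    case True
    have "near - {1..n} = {}" by auto
    then show ?thesis using True n out_deg_1[of "{1..n}"] by simp
  next
    case False
    then show ?thesis using that n out_deg_other[of i "{1..n}"] by simp
  qed
  have iff: "P \<in> sPF TYPE('k) n (G_edges n l) \<longleftrightarrow> P \<in> {1..n} \<rightarrow>\<^sub>E UNIV \<and> ?pos \<and>
      (\<forall>A. A \<noteq> {} \<and> A \<subset> {1..n} \<longrightarrow> (\<exists>i\<in>A. P i < ?d A i))"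
    by (rule sPF_iff) (use out1 n in simp_all)
  show ?thesis
    unfolding R_def[symmetric]
  proof
    assume "P \<in> sPF TYPE('k) n (G_edges n l)"
    then have pos: ?pos
      and sph: "\<And>A. A \<noteq> {} \<Longrightarrow> A \<subset> {1..n} \<Longrightarrow> \<exists>i\<in>A. P i < ?d A i"
      using iff by (blast, meson)
    have park: "c \<le> int (card {i\<in>{2..n}. R i < c})" if c: "c \<in> {1..M}" for c
    proof (rule ccontr)
      assume less: "\<not> ?thesis"
      define A where "A = {i\<in>{2..n}. c \<le> R i}"
      have "card {2..n} = card A + card {i\<in>{2..n}. R i < c}"
        unfolding A_def by (rule card_split_threshold) simp
      then have cA: "int (card A) = int n - 1 - int (card {i\<in>{2..n}. R i < c})"
        using n by simp
      have "A \<noteq> {}" using cA less c M_eq by (auto simp del: Collect_empty_eq)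
      moreover have "A \<subset> {1..n}"
      proof
        show "A \<subseteq> {1..n}" by (auto simp: A_def)
        have "1 \<notin> A" "1 \<in> {1..n}" using n by (auto simp: A_def)
        then show "A \<noteq> {1..n}" by blast
      qed
      ultimately obtain i where i: "i \<in> A" "P i < ?d A i" using sph by blast
      have "1 \<notin> A" "A \<subseteq> {1..n}" "i \<noteq> 1" "i \<in> {2..n}" using i by (auto simp: A_def)
      then have "int (P i) < int n + 1 - int (card A) - of_bool (i \<in> far)"
        using i out_deg_other[of i A] by simp
      then have "R i < c" using R_apply[OF \<open>i \<in> {2..n}\<close>] cA less by linarith
      then show False using i by (simp add: A_def)
    qed
    have M_all: "{i\<in>{2..n}. R i < M} = {2..n}"
      using park[of M] M_pos M_eq n by (intro card_seteq) (auto simp: M_def)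
    have pref: "R \<in> prefs"
    proof -
      have "R i \<in> {0..<M}" if "i \<in> {2..n}" for i
      proof -
        have "R i < M" using M_all that by blast
        moreover have "1 \<le> P i" using pos that by simp
        ultimately show ?thesis using R_apply[OF that] by simp
      qed
      then show ?thesis unfolding prefs_def by (intro PiE_I) (auto simp: R_def shifted_def)
    qed
    have u0: "uncrossed far R 0"
      unfolding uncrossed_0_iff[OF pref far]
    proof (intro conjI ballI)
      fix i assume "i \<in> far"
      then have "i \<in> {2..n}" "1 \<le> P i" using far pos by auto
      then show "R i \<noteq> 0" using R_apply[of i] \<open>i \<in> far\<close> by simp
    qed (use park in simp)
    have ?first
    proof (intro ballI impI)
      fix c assume c: "c \<in> {1..M}" "uncrossed far R c"
      have t: "int (card {i\<in>{2..n}. R i < c}) = c" "\<And>i. i \<in> far \<Longrightarrow> R i \<noteq> c"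
        using iffD1[OF uncrossed_iff_tight[OF pref far u0 c(1)] c(2)] by blast+
      define B where "B = {i\<in>{2..n}. c \<le> R i}"
      have "card {2..n} = card B + card {i\<in>{2..n}. R i < c}"
        unfolding B_def by (rule card_split_threshold) simp
      then have cB: "int (card B) = int n - 1 - c" using n t(1) by simp
      have B: "finite B" "1 \<notin> B" "B \<subseteq> {2..n}" by (auto simp: B_def)
      then have cA: "int (card (insert 1 B)) = int n - c" using cB by simp
      have "insert 1 B \<noteq> {1..n}" using cA c by force
      then have "insert 1 B \<subset> {1..n}" using B n by auto
      then obtain i where i: "i \<in> insert 1 B" "P i < ?d (insert 1 B) i"
        using sph[of "insert 1 B"] by blast
      have sub: "insert 1 B \<subseteq> {1..n}" using B n by auto
      have "i = 1"
      proof (rule ccontr)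
        assume "i \<noteq> 1"
        then have iB: "i \<in> B" using i by simp
        then have "i \<in> {2..n}" "c \<le> R i" by (auto simp: B_def)
        moreover have "int (P i) < c + 1"
          using out_deg_other[OF i(1) sub \<open>i \<noteq> 1\<close>] i(2) cA by simp
        ultimately show False using t(2)[of i] R_apply[of i] by (cases "i \<in> far") auto
      qed
      then have "P 1 < Suc (card (near - insert 1 B))" using i out_deg_1[OF _ sub] by simp
      moreover have "near - insert 1 B = {i \<in> near. R i < c}"
        using nl by (auto simp: B_def)
      ultimately show "P 1 \<le> card {i \<in> near. R i < c}" by simp
    qed
    then show "?pos \<and> R \<in> prefs \<and> uncrossed far R 0 \<and> ?first" using pos pref u0 by blast
  next
    assume "?pos \<and> R \<in> prefs \<and> uncrossed far R 0 \<and> ?first"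
    then have pos: ?pos and pref: "R \<in> prefs" and u0: "uncrossed far R 0" and first: ?first by blast+
    have park: "c \<le> int (card {i\<in>{2..n}. R i < c})" if c: "c \<in> {1..M}" for c
      using u0 that unfolding uncrossed_0_iff[OF pref far] by blast
    have "\<exists>i\<in>A. P i < ?d A i" if A: "A \<noteq> {}" "A \<subset> {1..n}" for A
    proof (rule ccontr)
      assume none: "\<not> ?thesis"
      have fin: "finite A" and sub: "A \<subseteq> {1..n}" using A finite_subset by blast+
      have cA: "1 \<le> card A" "card A \<le> n - 1"
        using A fin psubset_card_mono[of "{1..n}" A] by (auto simp: Suc_le_eq card_gt_0_iff)
      define c where "c = int n - int (card A)"
      define L where "L = {i\<in>{2..n}. R i < c}"
      have c: "c \<in> {1..M}" using cA n by (auto simp: c_def M_eq)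
      then have cL: "c \<le> int (card L)" using park by (simp add: L_def)
      have finL: "finite L" by (simp add: L_def)
      show False
      proof (cases "1 \<in> A")
        case False
        \<comment> \<open>\<open>A\<close> and \<open>L\<close> together have at least \<open>card A + c = n\<close> elements among only \<open>n - 1\<close> cars.\<close>
        have "A \<inter> L = {}"
        proof (rule ccontr)
          assume "A \<inter> L \<noteq> {}"
          then obtain i where i: "i \<in> A" "i \<in> {2..n}" "R i < c" by (auto simp: L_def)
          then have "int (P i) < int (?d A i)"
            using out_deg_other[OF i(1) sub] False R_apply[of i] by (simp add: c_def)
          then show False using none i(1) by auto
        qed
        then have "card (A \<union> L) = card A + card L" using fin finL by (simp add: card_Un_disjoint)
        moreover have "A \<union> L \<subseteq> {2..n}"
        proof
          fix x assume "x \<in> A \<union> L"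
          then show "x \<in> {2..n}" using sub False by (cases "x = 1") (auto simp: L_def)
        qed
        then have "card (A \<union> L) \<le> card {2..n}" by (intro card_mono) auto
        ultimately show False using cL n by (simp add: c_def)
      next
        case True
        define B where "B = A - {1}"
        have B: "B \<subseteq> {2..n}" "finite B" using sub fin by (auto simp: B_def)
        have cB: "int (card B) = int n - 1 - c"
          using card.remove[OF fin True] by (simp add: B_def c_def)
        have big: "c + of_bool (i \<in> far) \<le> R i" if "i \<in> B" for i
        proof -
          have i: "i \<in> A" "i \<noteq> 1" "i \<in> {2..n}" using that B by (auto simp: B_def)
          have "\<not> int (P i) < int (?d A i)" using none i(1) by auto
          then show ?thesis using out_deg_other[OF i(1) sub i(2)] True R_apply[OF i(3)] by (simp add: c_def)
        qed
        have "i \<notin> L" if "i \<in> B" for i using big[OF that] by (auto simp: L_def of_bool_def split: if_splits)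
        then have "B \<inter> L = {}" by blast
        then have cU: "card (B \<union> L) = card B + card L" using B finL by (simp add: card_Un_disjoint)
        have U: "B \<union> L \<subseteq> {2..n}" using B by (auto simp: L_def)
        then have le: "card (B \<union> L) \<le> card {2..n}" by (intro card_mono) auto
        then have eqL: "int (card L) = c" using cU cB cL n by simp
        then have all: "B \<union> L = {2..n}" using U cU cB n by (intro card_subset_eq) auto
        have "R i \<noteq> c" if i: "i \<in> far" for i
        proof
          assume Ri: "R i = c"
          then have "i \<notin> L" by (simp add: L_def)
          then have "i \<in> B" using all i far by blast
          then show False using big[of i] i Ri by simp
        qed
        then have "uncrossed far R c"
          using uncrossed_iff_tight[OF pref far u0 c] eqL by (simp add: L_def)
        then have "P 1 \<le> card {i \<in> near. R i < c}" using first c by blast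
        also have "{i \<in> near. R i < c} = near - A"
        proof -
          have "near \<subseteq> {2..n}" using nl by auto
          then have "{i \<in> near. R i < c} = near \<inter> L" by (auto simp: L_def)
          also have "\<dots> = near - B" using all \<open>B \<inter> L = {}\<close> \<open>near \<subseteq> {2..n}\<close> by blast
          also have "\<dots> = near - A" by (auto simp: B_def)
          finally show ?thesis .
        qed
        finally have "P 1 < ?d A 1" using out_deg_1[OF True sub] by simp
        then show False using none True by blast
      qed
    qed
    then have "\<forall>A. A \<noteq> {} \<and> A \<subset> {1..n} \<longrightarrow> (\<exists>i\<in>A. P i < ?d A i)" by simp
    with ext pos show "P \<in> sPF TYPE('k) n (G_edges n l)" unfolding iff by (intro conjI)
  qed
qed

text \<open>
  The bound on \<open>P 1\<close> gets weaker with growing \<open>c\<close>, so only the first uncrossed border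
  counts; there the admissible values of \<open>P 1\<close> are as many as the cars of \<open>near\<close> in the first block.
  The border \<open>M\<close> guarantees that a first one exists.
\<close>

lemma card_first_coordinates:
  assumes R: "R \<in> prefs" and u0: "uncrossed far R 0"
  shows "card {p. 1 \<le> p \<and> (\<forall>c\<in>{1..M}. uncrossed far R c \<longrightarrow> p \<le> card {i \<in> near. R i < c})}
    = card {i \<in> near. R \<in> first_block far i}" (is "card ?lhs = card ?rhs")
proof -
  define C where "C = {c \<in> {1..M}. uncrossed far R c}"
  have "uncrossed far R M" using u0 uncrossed_mod[of far R M] by simp
  then have "M \<in> C" using M_pos by (simp add: C_def)
  moreover have "C \<subseteq> {1..M}" by (auto simp: C_def)
  ultimately have "finite C" "C \<noteq> {}" using finite_subset by blast+
  define c where "c = Min C"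
  have c: "c \<in> C" "\<And>d. d \<in> C \<Longrightarrow> c \<le> d"
    using \<open>finite C\<close> \<open>C \<noteq> {}\<close> by (simp_all add: c_def)
  have mono: "card {i \<in> near. R i < c} \<le> card {i \<in> near. R i < d}" if "d \<in> C" for d
    using c(2)[OF that] by (intro card_mono) auto
  have "?lhs = {p. 1 \<le> p \<and> (\<forall>d\<in>C. p \<le> card {i \<in> near. R i < d})}" by (auto simp: C_def)
  also have "\<dots> = {1..card {i \<in> near. R i < c}}" using c(1) mono by (auto intro: order_trans)
  finally have "card ?lhs = card {i \<in> near. R i < c}" by simp
  also have "{i \<in> near. R i < c} = {i \<in> near. \<forall>d\<in>C. R i < d}" using c by force
  also have "\<dots> = ?rhs" using R u0 by (auto simp: first_block_def C_def)
  finally show ?thesis .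
qed

text \<open>
  Splitting \<open>P\<close> into the preferences of the cars and \<open>P 1\<close>, trading \<open>P 1\<close> for a car of \<open>near\<close> in the
  first block, and summing over this car first.
\<close>

lemma card_sPF_eq_sum:
  "card (sPF TYPE('k::field) n (G_edges n l)) = (\<Sum>i\<in>near. card (first_block far i))"
proof -
  define U where "U = {R \<in> prefs. uncrossed far R 0}"
  define V where "V R = {p. 1 \<le> p \<and> (\<forall>c\<in>{1..M}. uncrossed far R c \<longrightarrow> p \<le> card {i \<in> near. R i < c})}" for R
  define W where "W R = {i \<in> near. R \<in> first_block far i}" for R
  let ?S = "sPF TYPE('k) n (G_edges n l)"
  let ?f = "\<lambda>P. (shifted P, P 1)"
  let ?g = "\<lambda>(R, p). unshifted R p"
  have finU: "finite U" using finite_prefs by (simp add: U_def)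
  have far: "far \<subseteq> {2..n}" using n l by auto
  have ext: "P \<in> {1..n} \<rightarrow>\<^sub>E UNIV" if "P \<in> ?S" for P using that by (simp add: sPF_def)
  have nonneg: "of_bool (i \<in> far) \<le> R i" if R: "R \<in> U" and i: "i \<in> {2..n}" for R i
  proof -
    have Rp: "R \<in> prefs" and u0: "uncrossed far R 0" using R by (simp_all add: U_def)
    show ?thesis
      using prefs_bounds[OF Rp i] uncrossed_0_pos[OF Rp far u0, of i] by (auto simp: of_bool_def)
  qed
  have shifted_unshifted: "shifted (unshifted R p) = R" if R: "R \<in> U" for R p
  proof
    fix i
    show "shifted (unshifted R p) i = R i"
    proof (cases "i \<in> {2..n}")
      case True
      then show ?thesis using nonneg[OF R True] by (simp add: shifted_apply unshifted_apply)
    next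
      case False
      have "R \<in> {2..n} \<rightarrow>\<^sub>E {0..<M}" using R by (simp add: U_def prefs_def)
      then have "R i = undefined" using False by (rule PiE_arb)
      then show ?thesis unfolding shifted_def using False by (simp only: restrict_apply if_False)
    qed
  qed
  have unshifted_shifted: "unshifted (shifted P) (P 1) = P" if P: "P \<in> ?S" for P
  proof
    fix i
    consider "i = 1" | "i \<in> {2..n}" | "i \<notin> {1..n}" by force
    then show "unshifted (shifted P) (P 1) i = P i"
    proof cases
      case 1 then show ?thesis by (simp only: unshifted_1)
    next
      case 2 then show ?thesis by (simp add: shifted_apply unshifted_apply)
    next
      case 3
      then have "P i = undefined" using ext[OF P] by (rule PiE_arb[rotated])
      then show ?thesis unfolding unshifted_def using 3 by (simp only: restrict_apply if_False)
    qed
  qed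
  have to: "?f P \<in> (SIGMA R:U. V R)" if P: "P \<in> ?S" for P
    using P n unfolding sPF_G_iff[OF ext[OF P], where 'k = 'k] by (simp add: U_def V_def)
  have fro: "unshifted R p \<in> ?S" if R: "R \<in> U" and p: "p \<in> V R" for R p
  proof -
    have "1 \<le> unshifted R p i" if "i \<in> {1..n}" for i
    proof (cases "i = 1")
      case True
      then show ?thesis using p unshifted_1[of R p] by (simp add: V_def)
    next
      case False
      then have i: "i \<in> {2..n}" using that by auto
      have "1 \<le> R i + 1 - of_bool (i \<in> far)" using nonneg[OF R i] by linarith
      then have "nat 1 \<le> nat (R i + 1 - of_bool (i \<in> far))" by (rule nat_mono)
      then show ?thesis by (simp only: unshifted_apply[OF i] nat_1 One_nat_def)
    qed
    moreover have "unshifted R p \<in> {1..n} \<rightarrow>\<^sub>E UNIV" by (simp add: unshifted_def)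
    ultimately show ?thesis
      using R p unfolding U_def V_def
      by (simp add: sPF_G_iff shifted_unshifted[OF R] unshifted_1[simplified])
  qed
  have "bij_betw ?f ?S (SIGMA R:U. V R)"
    by (rule bij_betw_byWitness[where f' = ?g])
      (use to fro shifted_unshifted unshifted_shifted unshifted_1 in \<open>auto simp del: One_nat_def\<close>)
  then have "card ?S = card (SIGMA R:U. V R)" by (rule bij_betw_same_card)
  also have "\<dots> = (\<Sum>R\<in>U. card (W R))"
  proof -
    have cVW: "card (V R) = card (W R)" if "R \<in> U" for R
      using that card_first_coordinates[of R] by (simp add: U_def V_def W_def)
    have "finite (V R)" if "R \<in> U" for R
    proof -
      have "uncrossed far R M" using that uncrossed_mod[of far R M] by (simp add: U_def)
      then have "V R \<subseteq> {..card {i \<in> near. R i < M}}" using M_pos by (auto simp: V_def)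
      then show ?thesis using finite_subset by blast
    qed
    then show ?thesis using finU cVW by (simp add: card_SigmaI)
  qed
  also have "\<dots> = card (SIGMA R:U. W R)" using finU by (simp add: W_def)
  also have "\<dots> = card (SIGMA i:near. first_block far i)"
    by (rule bij_betw_same_card[of prod.swap])
      (auto simp: bij_betw_def inj_on_def W_def U_def first_block_def image_iff)
  also have "\<dots> = (\<Sum>i\<in>near. card (first_block far i))"
  proof -
    have "finite (first_block far i)" for i
      using finite_prefs by (rule rev_finite_subset) (auto simp: first_block_def)
    then show ?thesis by (simp add: card_SigmaI)
  qed
  finally show ?thesis .
qed

lemma card_sPF_G:
  "card (sPF TYPE('k::field) n (G_edges n l)) = (n - 1) ^ (n - 3) * (n - l - 1) ^ 2"
proof -
  have far: "far \<subseteq> {2..n}" and near: "near \<subseteq> {2..n}" using n l by auto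
  have card_I: "card {2..n} = n - 1" and card_far: "card far = l" using n l by auto
  have "card (first_block far i) = (n - l - 1) * (n - 1) ^ (n - 3)" if "i \<in> near" for i
    using card_first_block[OF far, of i] near that n l unfolding card_I card_far
    by (auto simp: subset_iff)
  then show ?thesis using l n by (simp add: card_sPF_eq_sum power2_eq_square)
qed

end

theorem theorem5p7:
  fixes n l :: nat
  assumes "n \<ge> 3" and "2 \<le> l" and "l \<le> n - 2"
  shows "card (sPF TYPE('k::field) n (G_edges n l)) = (n - 1) ^ (n - 3) * (n - l - 1) ^ 2"
  using assms(1,3) by (rule card_sPF_G)

end
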